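(* Let $d=d(n)$ be any integer-valued function with $d=\omega(1)$ as $n\to\infty$ (with $d<n$ and $dn$ even, so that $d$-regular graphs on $n$ vertices exist). Then there are a connected $d$-regular graph $G$ on $n$ vertices and a choice of tie-breaking permutations $\{\xi_v\}_{v\in V}$ for which the maximum load after $n$ balls are allocated by the local search allocation using the tie-breaking rule $\{\xi_v\}_{v\in V}$ is at least $\Omega\big(\min\big\{d^{1/4},\frac{\log n}{\log d}\big\}\big)$ with probability $1-o(1)$; that is, for some constant $c>0$ independent of $n$, $\Pr\big[X_{\max}^{(n)}\ge c\min\{d^{1/4},\tfrac{\log n}{\log d}\}\big]\to1$ as $n\to\infty$.
   Context: Local search allocation on a finite, undirected, connected graph $G=(V,E)$ with $|V|=n$, with tie-breaking rule $\{\xi_v\}_{v\in V}$: for each $v$, $\xi_v$ is a fixed permutation (ordering) of the neighbors of $v$. The vertices are bins, all initially with load $0$. Balls $1,2,\dots$ are allocated one after another. Ball $i$ is born at a vertex $U_i$ (its birthplace), where $U_1,U_2,\dots$ are independent and uniform on $V$. Starting at $U_i$, as long as the current vertex $v$ has a neighbor whose load is strictly smaller than the load of $v$, the ball moves to a neighbor of smallest load; ties among the neighbors of smallest load are broken using the order $\xi_v$ (the first one in the order is chosen). The search stops at the first vertex none of whose neighbors has a smaller load; the ball is placed there and the load of that vertex increases by $1$. $X_v^{(i)}$ is the load of $v$ right after ball $i$ is placed, and $X_{\max}^{(n)}=\max_{v\in V}X_v^{(n)}$. *)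

theory Defs
  imports
    "HOL-Probability.Probability"
    "HOL-Probability.Product_PMF"
    "HOL-Combinatorics.Multiset_Permutations"
    "Graph_Theory.Pair_Digraph"
    "Graph_Theory.Digraph_Component"
begin

text \<open>
  A finite simple undirected graph is a \<open>pair_graph\<close>: the edge \<open>{u, v}\<close> is represented by the two
  arcs \<open>(u, v)\<close> and \<open>(v, u)\<close>. The degree of a vertex is therefore its out-degree.
\<close>

definition neighbours :: "'a pair_pre_digraph \<Rightarrow> 'a \<Rightarrow> 'a set" where
  "neighbours G v = {w. (v, w) \<in> parcs G}"

definition regular_graph :: "nat \<Rightarrow> 'a pair_pre_digraph \<Rightarrow> bool" where
  "regular_graph k G \<longleftrightarrow> pair_graph G \<and> (\<forall>v \<in> pverts G. out_degree (with_proj G) v = k)"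

definition tie_breaking_rule :: "'a pair_pre_digraph \<Rightarrow> ('a \<Rightarrow> 'a list) \<Rightarrow> bool" where
  "tie_breaking_rule G \<xi> \<longleftrightarrow> (\<forall>v \<in> pverts G. \<xi> v \<in> permutations_of_set (neighbours G v))"

text \<open>
  The search below reads the neighbourhood of \<open>v\<close> off the list \<open>\<xi> v\<close>, since
  \<open>set (\<xi> v) = neighbours G v\<close> for every vertex \<open>v\<close> when \<open>\<xi>\<close> is a tie-breaking rule for \<open>G\<close>.
  The load configuration \<open>X\<close> does not change during the search.
\<close>

definition next_vertex :: "('a \<Rightarrow> 'a list) \<Rightarrow> ('a \<Rightarrow> nat) \<Rightarrow> 'a \<Rightarrow> 'a" where
  "next_vertex \<xi> X v = hd (filter (\<lambda>w. \<forall>u \<in> set (\<xi> v). X w \<le> X u) (\<xi> v))"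

lemma next_vertex_smallest:
  assumes "\<xi> v \<noteq> []"
  shows "next_vertex \<xi> X v \<in> set (\<xi> v)" and "\<forall>u \<in> set (\<xi> v). X (next_vertex \<xi> X v) \<le> X u"
proof -
  let ?P = "\<lambda>w. \<forall>u \<in> set (\<xi> v). X w \<le> X u"
  obtain w where "w \<in> set (\<xi> v)" "?P w"
    using assms ex_min_if_finite[of "X ` set (\<xi> v)"] by (fastforce simp: not_less)
  then have "filter ?P (\<xi> v) \<noteq> []"
    by (auto simp: filter_empty_conv)
  then have "next_vertex \<xi> X v \<in> set (filter ?P (\<xi> v))"
    unfolding next_vertex_def by (rule hd_in_set)
  then show "next_vertex \<xi> X v \<in> set (\<xi> v)" "?P (next_vertex \<xi> X v)"
    by auto
qed

function local_search :: "('a \<Rightarrow> 'a list) \<Rightarrow> ('a \<Rightarrow> nat) \<Rightarrow> 'a \<Rightarrow> 'a" where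
  "local_search \<xi> X v =
     (if \<exists>w \<in> set (\<xi> v). X w < X v then local_search \<xi> X (next_vertex \<xi> X v) else v)"
  by pat_completeness auto
termination
proof (relation "Wellfounded.measure (\<lambda>(\<xi>, X, v). X v)")
  fix \<xi> :: "'a \<Rightarrow> 'a list" and X :: "'a \<Rightarrow> nat" and v
  assume "\<exists>w \<in> set (\<xi> v). X w < X v"
  then obtain w where "w \<in> set (\<xi> v)" "X w < X v" by blast
  moreover from this have "X (next_vertex \<xi> X v) \<le> X w"
    using next_vertex_smallest(2)[of \<xi> v X] by force
  ultimately show "((\<xi>, X, next_vertex \<xi> X v), (\<xi>, X, v)) \<in> Wellfounded.measure (\<lambda>(\<xi>, X, v). X v)"
    by simp
qed simp

declare local_search.simps [simp del]

text \<open>\<open>U i\<close> is the birthplace of ball \<open>i\<close>; the balls are numbered from 1.\<close>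

primrec load :: "('a \<Rightarrow> 'a list) \<Rightarrow> (nat \<Rightarrow> 'a) \<Rightarrow> nat \<Rightarrow> 'a \<Rightarrow> nat" where
  "load \<xi> U 0 = (\<lambda>_. 0)"
| "load \<xi> U (Suc i) =
     (let X = load \<xi> U i; v = local_search \<xi> X (U (Suc i)) in X(v := X v + 1))"

definition max_load :: "'a pair_pre_digraph \<Rightarrow> ('a \<Rightarrow> 'a list) \<Rightarrow> (nat \<Rightarrow> 'a) \<Rightarrow> nat \<Rightarrow> nat" where
  "max_load G \<xi> U m = Max (load \<xi> U m ` pverts G)"

text \<open>
  The joint law of the birthplaces of balls \<open>1, \<dots>, m\<close>, independent and uniform on the vertices.
  \<open>Pi_pmf\<close> assigns the irrelevant value \<open>undefined\<close> to all other indices.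
\<close>

definition birthplaces :: "'a pair_pre_digraph \<Rightarrow> nat \<Rightarrow> (nat \<Rightarrow> 'a) pmf" where
  "birthplaces G m = Pi_pmf {1..m} undefined (\<lambda>_. pmf_of_set (pverts G))"

end

theory Submission
  imports Defs "HOL-Real_Asymp.Real_Asymp"
begin

text \<open>
  Let \<open>k\<close> be a small multiple of \<open>min (d\<^sup>1\<^sup>/\<^sup>4) (log n / log d)\<close>. If \<open>k\<close> stays bounded, any connected
  \<open>d\<close>-regular graph will do. Otherwise \<open>(d + 1)\<^sup>2\<^sup>k\<^sup>+\<^sup>1 \<le> n\<close>, and we take a spanning tree whose inner
  vertices all have degree \<open>d\<close>, complete it to a \<open>d\<close>-regular graph by edges between its outer vertices,
  and let every vertex prefer its parent. Divide the balls into \<open>k\<close> stages. Stage \<open>s\<close> raises all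
  vertices within distance \<open>2 (k - s)\<close> of the root from load \<open>s - 1\<close> to load \<open>s\<close>: if all vertices
  within distance 2 of \<open>r\<close> have load at least \<open>s - 1\<close>, and if two balls of the stage are born at the
  same child of \<open>r\<close>, then the first one leaves the child with load at least \<open>s\<close>, and the second one
  moves to \<open>r\<close> unless \<open>r\<close> has load \<open>s\<close> already. No child of \<open>r\<close> gets two balls in a stage with
  probability \<open>exp (- \<Omega> (d / k\<^sup>2))\<close>, and \<open>d / k\<^sup>2 \<ge> d\<^sup>1\<^sup>/\<^sup>2\<close> beats the logarithm \<open>O (k log d)\<close> of the
  number of pairs \<open>(s, r)\<close>.
\<close>

section \<open>Regular graphs\<close>

lemma regular_graph_relI:
  assumes "finite V" "A \<subseteq> V \<times> V" "sym A" "irrefl A" "\<And>v. v \<in> V \<Longrightarrow> card (A `` {v}) = k"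
  shows "regular_graph k \<lparr>pverts = V, parcs = A\<rparr>"
proof -
  have fin: "finite A"
    using assms(1,2) finite_subset by blast
  have deg: "card {e \<in> A. fst e = v} = card (A `` {v})" for v
  proof -
    have "{e \<in> A. fst e = v} = Pair v ` (A `` {v})"
      by force
    then show ?thesis
      by (simp add: card_image inj_on_def)
  qed
  have "pair_graph \<lparr>pverts = V, parcs = A\<rparr>"
    using assms fin
    by unfold_locales (auto simp: symmetric_def irrefl_def)
  then show ?thesis
    using assms(5) deg by (simp add: regular_graph_def out_degree_def out_arcs_def)
qed

text \<open>Descending along \<open>par\<close> leads from every vertex to 0, and connectivity may
  use arcs backwards. This serves both the circulant graph (\<open>par i = i - 1\<close>) and the
  tree (\<open>heap_parent\<close>).\<close>

lemma connected_if_parent: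
  fixes par :: "nat \<Rightarrow> nat"
  assumes "n > 0" "\<And>i. \<lbrakk>0 < i; i < n\<rbrakk> \<Longrightarrow> par i < i \<and> (i, par i) \<in> A"
  shows "Digraph_Component.connected (with_proj \<lparr>pverts = {0..<n}, parcs = A\<rparr>)"
proof -
  have to0: "(i, 0) \<in> rtrancl_on {0..<n} (A\<^sup>s)" if "i < n" for i
    using that
  proof (induction i rule: less_induct)
    case (less i)
    show ?case
    proof (cases "i = 0")
      case False
      then have "par i < i" "(i, par i) \<in> A" using assms(2) less.prems by auto
      moreover from this have "(par i, 0) \<in> rtrancl_on {0..<n} (A\<^sup>s)"
        using less by simp
      ultimately show ?thesis
        using less.prems by (intro converse_rtrancl_on_into_rtrancl_on[of i "par i"]) (auto simp: symcl_def)
    qed (use assms in auto)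
  qed
  have cv: "(A\<^sup>s)\<inverse> = A\<^sup>s"
    by (auto simp: symcl_def)
  have from0: "(0, i) \<in> rtrancl_on {0..<n} (A\<^sup>s)" if "i < n" for i
    using rtrancl_on_converseI[OF to0[OF that]] unfolding cv .
  show ?thesis
    unfolding connected_conv with_proj_simps
    using assms(1) by (auto intro: rtrancl_on_trans[OF to0 from0])
qed

section \<open>Completing a graph to a regular one by edge switching\<close>

lemma even_card_sym_irrefl:
  fixes A :: "'a :: linorder rel"
  assumes "finite A" "sym A" "irrefl A"
  shows "even (card A)"
proof -
  define B where "B = {(x, y) \<in> A. x < y}"
  have A: "A = B \<union> B\<inverse>"
    using assms unfolding B_def sym_def irrefl_def by (auto, metis linorder_neqE)
  have "B \<inter> B\<inverse> = {}"
    unfolding B_def by auto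
  moreover have "finite B"
    using assms(1) by (rule rev_finite_subset) (auto simp: B_def)
  ultimately have "card A = card B + card B"
    by (subst A) (simp add: card_Un_disjoint)
  then show ?thesis by simp
qed

lemma card_rel_eq_sum:
  assumes "finite V" "A \<subseteq> V \<times> V"
  shows "card A = (\<Sum>v\<in>V. card (A `` {v}))"
proof -
  have "A = Sigma V (\<lambda>v. A `` {v})"
    using assms(2) by auto
  moreover have "finite (A `` {v})" for v
    by (rule finite_subset[OF _ assms(1)]) (use assms(2) in auto)
  ultimately show ?thesis
    using assms(1) by (metis card_SigmaI)
qed

text \<open>
  In a maximal supergraph of maximum degree at most \<open>d\<close>, vertices \<open>u\<close>, \<open>v\<close> of too small degree
  (or \<open>u = v\<close> if \<open>u\<close> lacks two edges) admit no edge \<open>{x, y}\<close> outside \<open>T\<close> that could be replaced by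
  \<open>{u, x}\<close> and \<open>{v, y}\<close>; hence there are few edges outside \<open>T\<close>.
\<close>

lemma extend_to_regular:
  fixes T :: "'a :: linorder rel"
  assumes V: "finite V" and T: "T \<subseteq> V \<times> V" "sym T" "irrefl T"
    and deg: "\<And>v. v \<in> V \<Longrightarrow> card (T `` {v}) \<le> d"
    and ev: "even (d * card V)" and big: "card T + 3 * d ^ 2 < d * card V"
  obtains A where "T \<subseteq> A" "A \<subseteq> V \<times> V" "sym A" "irrefl A"
    "\<And>v. v \<in> V \<Longrightarrow> card (A `` {v}) = d"
proof -
  define P where "P A \<longleftrightarrow> T \<subseteq> A \<and> A \<subseteq> V \<times> V \<and> sym A \<and> irrefl A \<and>
    (\<forall>v\<in>V. card (A `` {v}) \<le> d)" for A
  have finV2: "finite (V \<times> V)" using V by simp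
  have bound: "card A < Suc (card (V \<times> V))" if "P A" for A
    using that card_mono[OF finV2] unfolding P_def by (simp add: le_imp_less_Suc)
  have "P T" using T deg by (simp add: P_def)
  then obtain A where PA: "P A" and max: "\<And>B. P B \<Longrightarrow> card B \<le> card A"
    using ex_has_greatest_nat[of P T card "Suc (card (V \<times> V))"] bound by blast
  have A: "T \<subseteq> A" "A \<subseteq> V \<times> V" "sym A" "irrefl A" and degA: "\<And>v. v \<in> V \<Longrightarrow> card (A `` {v}) \<le> d"
    using PA by (auto simp: P_def)
  have symA: "(a, b) \<in> A \<longleftrightarrow> (b, a) \<in> A" for a b using A(3) by (auto simp: sym_def)
  have irA: "(a, a) \<notin> A" for a using A(4) by (auto simp: irrefl_def)
  have finA: "finite A" using A(2) finV2 finite_subset by blast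
  have finN [simp]: "finite (A `` {v})" for v
    by (rule finite_subset[OF _ V]) (use A in auto)
  \<comment> \<open>By maximality: two distinct non-adjacent vertices of degree below d could be
    joined.\<close>
  have adj: "(u, v) \<in> A"
    if "u \<in> V" "v \<in> V" "u \<noteq> v" "card (A `` {u}) < d" "card (A `` {v}) < d" for u v
  proof (rule ccontr)
    assume not: "(u, v) \<notin> A"
    define B where "B = A \<union> {(u, v), (v, u)}"
    have Bd: "card (B `` {w}) \<le> d" if "w \<in> V" for w
    proof -
      consider "w = u" | "w = v" | "w \<noteq> u" "w \<noteq> v" by blast
      then show ?thesis
      proof cases
        case 1
        then have "B `` {w} = insert v (A `` {u})" using \<open>u \<noteq> v\<close> by (auto simp: B_def)
        then show ?thesis using \<open>card (A `` {u}) < d\<close> by (simp add: card_insert_if)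
      next
        case 2
        then have "B `` {w} = insert u (A `` {v})" using \<open>u \<noteq> v\<close> by (auto simp: B_def)
        then show ?thesis using \<open>card (A `` {v}) < d\<close> by (simp add: card_insert_if)
      next
        case 3
        then have "B `` {w} = A `` {w}" by (auto simp: B_def)
        then show ?thesis using degA[OF that] by simp
      qed
    qed
    have "P B"
      unfolding P_def using A that Bd by (auto simp: B_def sym_def irrefl_def)
    moreover have "card A < card B"
      by (rule psubset_card_mono) (use finA not in \<open>auto simp: B_def\<close>)
    ultimately show False using max[of B] by simp
  qed
  have "card (A `` {u}) = d" if u: "u \<in> V" for u
  proof (rule ccontr)
    assume "card (A `` {u}) \<noteq> d"
    with degA[OF u] have du: "card (A `` {u}) < d" by simp
    \<comment> \<open>If u is the only deficient vertex, its deficit is the difference of the even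
      numbers \<open>d * card V\<close> and \<open>card A\<close>. It is thus at least 2, and
      \<open>v = u\<close> will do.\<close>
    obtain v where v: "v \<in> V" "card (A `` {v}) < d" "v = u \<Longrightarrow> card (A `` {u}) + 2 \<le> d"
    proof (cases "\<exists>v\<in>V. v \<noteq> u \<and> card (A `` {v}) < d")
      case False
      then have "card (A `` {w}) = d" if "w \<in> V - {u}" for w
        using that degA[of w] by force
      then have "(\<Sum>w\<in>V - {u}. card (A `` {w})) = (card V - 1) * d"
        using u V by simp
      then have "card A = card (A `` {u}) + (card V - 1) * d"
        using card_rel_eq_sum[OF V A(2)] sum.remove[OF V u, of "\<lambda>v. card (A `` {v})"] by simp
      moreover have "card V = Suc (card V - 1)"
        using u V by (metis Suc_pred' card_gt_0_iff empty_iff)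
      then have "d * card V = d + (card V - 1) * d"
        by (metis mult.commute mult_Suc)
      ultimately have "card A + (d - card (A `` {u})) = d * card V"
        using du by simp
      with ev even_card_sym_irrefl[OF finA A(3,4)] have "even (d - card (A `` {u}))"
        by (metis even_add)
      then have "d - card (A `` {u}) \<noteq> 1" by (metis odd_one)
      with du have "card (A `` {u}) + 2 \<le> d" by simp
      then show ?thesis using that[of u] u du by simp
    qed (use that in blast)
    define Nu where "Nu = insert u (A `` {u})"
    define Nv where "Nv = insert v (A `` {v})"
    have sub: "Nu \<subseteq> V" "Nv \<subseteq> V" using u v A(2) by (auto simp: Nu_def Nv_def)
    have fin: "finite Nu" "finite Nv" using sub V finite_subset by auto
    have cN: "card Nu \<le> d" "card Nv \<le> d"
      using du v(2) unfolding Nu_def Nv_def by (simp_all add: card_insert_if)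
    show False
    proof (cases "\<exists>x y. (x, y) \<in> A - T \<and> x \<notin> Nu \<and> y \<notin> Nv")
      case True
      then obtain x y where xy: "(x, y) \<in> A" "(x, y) \<notin> T" "x \<notin> Nu" "y \<notin> Nv" by blast
      have yx: "(y, x) \<in> A" "(y, x) \<notin> T" using xy symA T(2) by (auto dest: symD)
      have ne: "x \<noteq> y" "x \<noteq> u" "y \<noteq> v" "x \<noteq> v" "y \<noteq> u"
        using xy yx irA symA unfolding Nu_def Nv_def by auto
      have non: "(u, x) \<notin> A" "(x, u) \<notin> A" "(v, y) \<notin> A" "(y, v) \<notin> A"
        using xy symA unfolding Nu_def Nv_def by auto
      have inV: "x \<in> V" "y \<in> V" using xy A(2) by auto
      define S where "S = {(u, x), (x, u), (v, y), (y, v)}"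
      \<comment> \<open>The switch keeps the degrees of x and y, spends one missing edge each at u
        and v (two if \<open>u = v\<close>), and trades two arcs for four.\<close>
      define B where "B = (A - {(x, y), (y, x)}) \<union> S"
      have Bd: "card (B `` {w}) \<le> d" if "w \<in> V" for w
      proof -
        consider "w = u" "u = v" | "w = u" "u \<noteq> v" | "w = v" "u \<noteq> v" | "w = x" | "w = y"
          | "w \<notin> {u, v, x, y}" by blast
        then show ?thesis
        proof cases
          case 1
          then have "B `` {w} = insert x (insert y (A `` {u}))"
            using ne by (auto simp: B_def S_def)
          moreover have "card \<dots> \<le> card (A `` {u}) + 2"
            by (simp add: card_insert_if)
          ultimately show ?thesis using v(3) 1 by simp
        next
          case 2
          then have "B `` {w} = insert x (A `` {u})" using ne by (auto simp: B_def S_def)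
          then show ?thesis using du by (simp add: card_insert_if)
        next
          case 3
          then have "B `` {w} = insert y (A `` {v})" using ne by (auto simp: B_def S_def)
          then show ?thesis using v(2) by (simp add: card_insert_if)
        next
          case 4
          then have "B `` {w} = insert u (A `` {x} - {y})" using ne by (auto simp: B_def S_def)
          moreover have "card (A `` {x} - {y}) < card (A `` {x})"
            using xy by (intro psubset_card_mono) auto
          ultimately show ?thesis using degA[OF inV(1)] by (simp add: card_insert_if)
        next
          case 5
          then have "B `` {w} = insert v (A `` {y} - {x})" using ne by (auto simp: B_def S_def)
          moreover have "card (A `` {y} - {x}) < card (A `` {y})"
            using yx by (intro psubset_card_mono) auto
          ultimately show ?thesis using degA[OF inV(2)] by (simp add: card_insert_if)
        next
          case 6
          then have "B `` {w} = A `` {w}" by (auto simp: B_def S_def)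
          then show ?thesis using degA[OF that] by simp
        qed
      qed
      have "sym B"
        unfolding B_def S_def sym_def using symA by auto
      moreover have "irrefl B"
        unfolding B_def S_def irrefl_def using irA ne by auto
      moreover have "T \<subseteq> B" "B \<subseteq> V \<times> V"
        using A(1,2) xy yx inV u v(1) unfolding B_def S_def by auto
      ultimately have "P B" using Bd by (simp add: P_def)
      have "card (A - {(x, y), (y, x)}) = card A - 2"
        using xy yx finA ne by (simp add: card_Diff_subset)
      moreover have "card A \<ge> 2"
        using card_mono[OF finA, of "{(x, y), (y, x)}"] xy yx ne by simp
      moreover have "card S = 4"
        unfolding S_def using ne by auto
      moreover have "card B = card (A - {(x, y), (y, x)}) + card S"
        unfolding B_def using finA non by (intro card_Un_disjoint) (auto simp: S_def)
      ultimately have "card A < card B" by simp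
      with max[OF \<open>P B\<close>] show False by simp
    next
      case False
      \<comment> \<open>Every arc outside T starts in \<open>Nu\<close> or ends in
        \<open>Nv\<close>, so there are at most 2 d^2 of them. Vertices outside \<open>Nu\<close>
        have full degree by \<open>adj\<close>; the at most d vertices in \<open>Nu\<close> account
        for the third d^2 in \<open>big\<close>.\<close>
      have "A - T \<subseteq> Sigma Nu (\<lambda>x. A `` {x}) \<union> (Sigma Nv (\<lambda>y. A `` {y}))\<inverse>"
        using False symA by auto
      moreover have "card (Sigma N (\<lambda>x. A `` {x})) \<le> d * d"
        if "finite N" "N \<subseteq> V" "card N \<le> d" for N
      proof -
        have "card (Sigma N (\<lambda>x. A `` {x})) = (\<Sum>x\<in>N. card (A `` {x}))"
          using that by simp
        also have "\<dots> \<le> card N * d"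
          using that degA by (intro sum_bounded_above[where K = d, simplified]) auto
        finally show ?thesis using that(3) by (meson le_trans mult_le_mono1)
      qed
      ultimately have "card (A - T) \<le> d * d + d * d"
        using fin sub cN
        by (smt (verit) add_mono card_Un_le card_inverse card_mono finite_Un finite_SigmaI
            finite_converse finN le_trans)
      moreover have "card A = card T + card (A - T)"
        using A(1) finA by (metis card_Diff_subset card_mono finite_subset le_add_diff_inverse)
      moreover have "d * (card V - card Nu) \<le> card A"
      proof -
        have "card (A `` {w}) = d" if "w \<in> V - Nu" for w
          using adj[of u w] that u du degA[of w] unfolding Nu_def by force
        then have "(\<Sum>w\<in>V - Nu. card (A `` {w})) = d * (card V - card Nu)"
          using sub fin by (simp add: card_Diff_subset)
        moreover have "(\<Sum>w\<in>V - Nu. card (A `` {w})) \<le> (\<Sum>w\<in>V. card (A `` {w}))"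
          using V by (intro sum_mono2) auto
        ultimately show ?thesis using card_rel_eq_sum[OF V A(2)] by simp
      qed
      moreover have "d * card V \<le> d * (card V - card Nu) + d * d"
        using cN(1) by (metis add_mult_distrib2 diff_le_mono2 le_diff_conv mult_le_mono2)
      ultimately show False using big by (simp add: power2_eq_square)
    qed
  qed
  with A show ?thesis using that by blast
qed

section \<open>Circulant graphs and regular completions of a tree\<close>

text \<open>Jumps modulo n by at most h in either direction, and for odd d also by n / 2, where n
  must be even. The jump by 1 yields the path that makes the graph connected.\<close>

lemma circulant_relation:
  assumes "2 \<le> d" "d < n" "even (d * n)"
  obtains A where "A \<subseteq> {0..<n} \<times> {0..<n}" "sym A" "irrefl A"
    "\<And>v. v \<in> {0..<n} \<Longrightarrow> card (A `` {v}) = d" "\<And>i. \<lbrakk>0 < i; i < n\<rbrakk> \<Longrightarrow> (i, i - 1) \<in> A"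
proof -
  define h where "h = d div 2"
  define S where "S = {1..h} \<union> {n - h..<n} \<union> (if odd d then {n div 2} else {})"
  have h: "1 \<le> h" "2 * h \<le> d" "odd d \<Longrightarrow> d = 2 * h + 1" "even d \<Longrightarrow> d = 2 * h"
    using assms(1) by (auto simp: h_def)
  have nd: "even n" if "odd d" using assms(3) that by simp
  have S: "S \<subseteq> {1..<n}" "1 \<in> S" "card S = d" "\<And>s. s \<in> S \<Longrightarrow> n - s \<in> S"
  proof -
    show "S \<subseteq> {1..<n}" "1 \<in> S"
      using h assms by (auto simp: S_def)
    show "n - s \<in> S" if "s \<in> S" for s
      using that h assms nd by (auto simp: S_def split: if_splits)
    have "card ({1..h} \<union> {n - h..<n}) = 2 * h"
      using h assms by (subst card_Un_disjoint) auto
    moreover have "n div 2 \<notin> {1..h} \<union> {n - h..<n}" if "odd d"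
      using h assms nd that by auto
    ultimately show "card S = d"
      using h by (auto simp: S_def)
  qed
  \<comment> \<open>\<open>S\<close> is closed under taking n - s, so absolute differences can
    replace differences modulo n.\<close>
  define A where "A = {(u, v). u < n \<and> v < n \<and> (if u < v then v - u else u - v) \<in> S}"
  show ?thesis
  proof (rule that)
    show "A \<subseteq> {0..<n} \<times> {0..<n}" "sym A" "irrefl A" "\<And>i. \<lbrakk>0 < i; i < n\<rbrakk> \<Longrightarrow> (i, i - 1) \<in> A"
      using S(1,2) by (auto simp: A_def sym_def irrefl_def split: if_splits)
    fix u assume "u \<in> {0..<n}"
    then have "bij_betw (\<lambda>s. if s \<le> u then u - s else u + n - s) S (A `` {u})"
      using S(1,4)
      by (intro bij_betw_byWitness[where f' = "\<lambda>v. if v < u then u - v else n - (v - u)"])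
        (force simp: A_def split: if_splits)+
    then show "card (A `` {u}) = d"
      using S(3) by (simp add: bij_betw_same_card[symmetric])
  qed
qed

text \<open>
  The tree in breadth-first numbering: the children of the root 0 are \<open>1, \<dots>, d\<close>, and those of
  \<open>v > 0\<close> are \<open>(d - 1) v + 2, \<dots>, (d - 1) v + d\<close>. Truncated subtraction makes 1 a child of 0.
\<close>

definition heap_parent :: "nat \<Rightarrow> nat \<Rightarrow> nat" where
  "heap_parent d i = (i - 2) div (d - 1)"

definition heap_children :: "nat \<Rightarrow> nat \<Rightarrow> nat \<Rightarrow> nat set" where
  "heap_children d n v = {i. 0 < i \<and> i < n \<and> heap_parent d i = v}"

lemma heap_parent_less: "0 < i \<Longrightarrow> heap_parent d i < i"
  unfolding heap_parent_def
  by (cases "i = 1") (auto intro: le_less_trans[OF div_le_dividend])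

lemma heap_children_subset:
  assumes "2 \<le> d"
  shows "heap_children d n v \<subseteq> (if v = 0 then {1..d} else {(d - 1) * v + 2..(d - 1) * v + d})"
proof
  fix i assume "i \<in> heap_children d n v"
  then have i: "0 < i" "(i - 2) div (d - 1) = v"
    by (auto simp: heap_children_def heap_parent_def)
  define p where "p = (d - 1) * v"
  have "p \<le> i - 2"
    using i(2) times_div_less_eq_dividend[of "d - 1" "i - 2"] by (simp add: p_def)
  moreover have "i - 2 < p + (d - 1)"
    using i(2) dividend_less_times_div[of "d - 1" "i - 2"] assms by (simp add: p_def)
  moreover have "v \<noteq> 0 \<longleftrightarrow> p > 0"
    using assms by (simp add: p_def)
  ultimately have "i \<in> (if v = 0 then {1..d} else {p + 2..p + d})"
    using i(1) assms by (auto simp: p_def[symmetric])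
  then show "i \<in> (if v = 0 then {1..d} else {(d - 1) * v + 2..(d - 1) * v + d})"
    unfolding p_def .
qed

lemma heap_children_superset:
  assumes "2 \<le> d" "(d - 1) * v + d < n"
  shows "(if v = 0 then {1..d} else {(d - 1) * v + 2..(d - 1) * v + d}) \<subseteq> heap_children d n v"
proof
  fix i assume i: "i \<in> (if v = 0 then {1..d} else {(d - 1) * v + 2..(d - 1) * v + d})"
  define r where "r = i - 2 - (d - 1) * v"
  have "i - 2 = (d - 1) * v + r" "r < d - 1"
    using i assms(1) by (auto simp: r_def split: if_splits)
  then have "(i - 2) div (d - 1) = v" by simp
  then show "i \<in> heap_children d n v"
    using i assms by (auto simp: heap_children_def heap_parent_def split: if_splits)
qed

text \<open>The tree has fewer than 2 n arcs and 3 d^2 \<le> 3 n, so \<open>5 \<le> d\<close> leaves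
  room for \<open>extend_to_regular\<close>. A vertex v with
  \<open>(d + 1) * (v + 1) \<le> n\<close> has degree d in the tree already. It gains no further
  edges, so its neighbours are its parent and its children, which gives the last property.\<close>

lemma heap_regular_relation:
  assumes d: "5 \<le> d" and n: "d ^ 2 \<le> n" and ev: "even (d * n)"
  obtains A where "A \<subseteq> {0..<n} \<times> {0..<n}" "sym A" "irrefl A"
    "\<And>v. v \<in> {0..<n} \<Longrightarrow> card (A `` {v}) = d"
    "\<And>i. \<lbrakk>0 < i; i < n\<rbrakk> \<Longrightarrow> (i, heap_parent d i) \<in> A"
    "\<And>v w. \<lbrakk>(d + 1) * (v + 1) \<le> n; (v, w) \<in> A\<rbrakk> \<Longrightarrow> w < (d + 1) * (v + 1)"
proof -
  define T where "T = {(i, heap_parent d i) |i. 0 < i \<and> i < n} \<union> {(heap_parent d i, i) |i. 0 < i \<and> i < n}"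
  have T: "T \<subseteq> {0..<n} \<times> {0..<n}" "sym T" "irrefl T"
  proof -
    have "heap_parent d i < n" "heap_parent d i \<noteq> i" if "0 < i" "i < n" for i
      using heap_parent_less[OF that(1), of d] that(2) by auto
    then show "T \<subseteq> {0..<n} \<times> {0..<n}" "sym T" "irrefl T"
      by (auto simp: T_def sym_def irrefl_def) metis
  qed
  have nb: "T `` {v} = heap_children d n v \<union> (if 0 < v \<and> v < n then {heap_parent d v} else {})" for v
    by (auto simp: T_def heap_children_def)
  have finC: "finite (heap_children d n v)" for v by (simp add: heap_children_def)
  have disj: "heap_parent d v \<notin> heap_children d n v" if "0 < v" for v
    using heap_parent_less[of v d] heap_parent_less[of "heap_parent d v" d] that
    by (auto simp: heap_children_def)
  have cC: "card (heap_children d n v) \<le> (if v = 0 then d else d - 1)" for v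
    using card_mono[OF _ heap_children_subset[of d n v]] d by (auto split: if_splits)
  have degT: "card (T `` {v}) \<le> d" for v
    using cC[of v] d unfolding nb by (auto simp: card_insert_if finC split: if_splits)
  have "T \<subseteq> (\<lambda>i. (i, heap_parent d i)) ` {1..<n} \<union> (\<lambda>i. (heap_parent d i, i)) ` {1..<n}"
    by (auto simp: T_def)
  then have "card T \<le> card ((\<lambda>i. (i, heap_parent d i)) ` {1..<n} \<union> (\<lambda>i. (heap_parent d i, i)) ` {1..<n})"
    by (intro card_mono) auto
  also have "\<dots> \<le> card {1..<n} + card {1..<n}"
    by (intro order.trans[OF card_Un_le] add_mono card_image_le) auto
  finally have "card T \<le> 2 * (n - 1)" by simp
  moreover have "n > 0" using n d by (metis gr0I le_zero_eq not_numeral_le_zero power_not_zero)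
  moreover have "5 * n \<le> d * n" using d by simp
  ultimately have "card T + 3 * d ^ 2 < d * n" using n by linarith
  then obtain A where A: "T \<subseteq> A" "A \<subseteq> {0..<n} \<times> {0..<n}" "sym A" "irrefl A"
      "\<And>v. v \<in> {0..<n} \<Longrightarrow> card (A `` {v}) = d"
    using extend_to_regular[of "{0..<n}" T d] T degT ev by auto
  show ?thesis
  proof (rule that[OF A(2-5)])
    show "(i, heap_parent d i) \<in> A" if "0 < i" "i < n" for i
      using A(1) that by (auto simp: T_def)
    fix v w assume v: "(d + 1) * (v + 1) \<le> n" and w: "(v, w) \<in> A"
    have eq: "(d - 1) * v = d * v - v" "v \<le> d * v" using d by (simp_all add: diff_mult_distrib)
    have vn: "(d - 1) * v + d < n" "v < n" using v eq by (simp_all add: algebra_simps)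
    have C: "heap_children d n v = (if v = 0 then {1..d} else {(d - 1) * v + 2..(d - 1) * v + d})"
      using heap_children_subset[of d n v] heap_children_superset[of d v n] d vn by auto
    have "card (T `` {v}) = d"
      unfolding nb using d vn disj[of v] finC[of v] by (auto simp: C)
    moreover have "finite (A `` {v})" by (rule finite_subset[of _ "{0..<n}"]) (use A(2) in auto)
    moreover have "T `` {v} \<subseteq> A `` {v}" using A(1) by auto
    ultimately have "T `` {v} = A `` {v}"
      using A(5)[of v] vn by (intro card_subset_eq) auto
    with w have "w \<in> T `` {v}" by auto
    then show "w < (d + 1) * (v + 1)"
      using heap_parent_less[of v d] eq unfolding nb C by (auto split: if_splits)
  qed
qed

lemma card_heap_children_ge:
  assumes "2 \<le> d" "(d + 1) * (v + 1) \<le> n"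
  shows "card (heap_children d n v) \<ge> d - 1"
proof -
  have "(d - 1) * v = d * v - v" "v \<le> d * v" using assms by (simp_all add: diff_mult_distrib)
  then have "(d - 1) * v + d < n" using assms(2) by (simp add: algebra_simps)
  moreover have "finite (heap_children d n v)" by (simp add: heap_children_def)
  ultimately show ?thesis
    using card_mono[OF _ heap_children_superset[OF assms(1)], of n v] by (auto split: if_splits)
qed

section \<open>Dynamics of the loads\<close>

lemma local_search_minimal:
  "w \<in> set (\<xi> (local_search \<xi> X v)) \<Longrightarrow> X (local_search \<xi> X v) \<le> X w"
proof (induction \<xi> X v rule: local_search.induct)
  case (1 \<xi> X v)
  show ?case
  proof (cases "\<exists>w \<in> set (\<xi> v). X w < X v")
    case True
    then have eq: "local_search \<xi> X v = local_search \<xi> X (next_vertex \<xi> X v)"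
      by (subst local_search.simps) simp
    show ?thesis
      unfolding eq by (rule 1(1)[OF True]) (use 1(2) eq in simp)
  next
    case False
    then have "local_search \<xi> X v = v"
      by (subst local_search.simps) simp
    then show ?thesis using False 1(2) by (auto simp: not_less)
  qed
qed

lemma local_search_closed:
  assumes "\<And>u. u \<in> V \<Longrightarrow> set (\<xi> u) \<subseteq> V"
  shows "v \<in> V \<Longrightarrow> local_search \<xi> X v \<in> V"
proof (induction "X v" arbitrary: v rule: less_induct)
  case less
  show ?case
  proof (cases "\<exists>w \<in> set (\<xi> v). X w < X v")
    case True
    then obtain w where w: "w \<in> set (\<xi> v)" "X w < X v" by blast
    then have "\<xi> v \<noteq> []" by auto
    note nx = next_vertex_smallest[where \<xi> = \<xi> and v = v and X = X, OF this]
      have "X (next_vertex \<xi> X v) < X v" using nx(2) w by force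
    moreover have "next_vertex \<xi> X v \<in> V" using nx(1) assms less.prems by blast
    ultimately have "local_search \<xi> X (next_vertex \<xi> X v) \<in> V" by (rule less.hyps)
    then show ?thesis using True by (subst local_search.simps) simp
  qed (use less.prems in \<open>subst local_search.simps, simp\<close>)
qed

lemma local_search_stays:
  assumes "\<And>w. w \<in> set (\<xi> v) \<Longrightarrow> X v \<le> X w"
  shows "local_search \<xi> X v = v"
proof -
  have "\<not> (\<exists>w \<in> set (\<xi> v). X w < X v)"
    using assms by (auto simp: not_less)
  then show ?thesis
    by (subst local_search.simps) (simp only: if_False)
qed

lemma load_Suc_ge: "load \<xi> U i v \<le> load \<xi> U (Suc i) v"
  by (simp add: Let_def)

lemma load_mono: "i \<le> j \<Longrightarrow> load \<xi> U i v \<le> load \<xi> U j v"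
  using lift_Suc_mono_le[of "\<lambda>i. load \<xi> U i v"] load_Suc_ge[of \<xi> U _ v] by blast

text \<open>A vertex gains a ball only while no neighbour has a smaller load, and gains elsewhere
  never increase its lead.\<close>

lemma load_le_neighbour: "w \<in> set (\<xi> v) \<Longrightarrow> load \<xi> U i v \<le> load \<xi> U i w + 1"
proof (induction i)
  case (Suc i)
  then show ?case
    using local_search_minimal[of w \<xi> "load \<xi> U i" "U (Suc i)"]
    by (auto simp: Let_def)
qed simp

lemma load_ge_if_child_hit_twice:
  assumes nr: "\<And>w. w \<in> set (\<xi> r) \<Longrightarrow> load \<xi> U i0 w \<ge> s"
    and nc: "\<And>w. w \<in> set (\<xi> c) \<Longrightarrow> load \<xi> U i0 w \<ge> s"
    and r: "load \<xi> U i0 r \<ge> s" and c: "load \<xi> U i0 c \<ge> s" and \<xi>: "\<xi> c = r # xs"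
    and ij: "i0 < i" "i < j" "j \<le> i1" "U i = c" "U j = c"
  shows "load \<xi> U i1 r \<ge> Suc s"
proof -
  obtain i' where i': "i = Suc i'"
    using ij(1) by (cases i) auto
  obtain j' where j': "j = Suc j'"
    using ij(2) by (cases j) auto
  have late: "s \<le> load \<xi> U l w" if "i0 \<le> l" "s \<le> load \<xi> U i0 w" for l w
    using that(2) load_mono[OF that(1), of \<xi> U w] by linarith
  have "load \<xi> U i c \<ge> Suc s"
  proof (cases "load \<xi> U i' c \<ge> Suc s")
    case True
    then show ?thesis unfolding i' using load_Suc_ge[of \<xi> U i' c] by linarith
  next
    case False
    \<comment> \<open>c has load exactly s and its neighbours at least s, so the first ball stays at
      c.\<close>
    then have "local_search \<xi> (load \<xi> U i') c = c"
      by (intro local_search_stays) (use late[of i'] nc ij i' in fastforce)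
    then show ?thesis using late[of i' c] c ij i' by (simp add: Let_def)
  qed
  then have cj: "load \<xi> U j' c \<ge> Suc s"
    using load_mono[of i j' \<xi> U c] ij j' by simp
  have "load \<xi> U j r \<ge> Suc s"
  proof (cases "load \<xi> U j' r \<ge> Suc s")
    case True
    then show ?thesis unfolding j' using load_Suc_ge[of \<xi> U j' r] by linarith
  next
    case False
    let ?X = "load \<xi> U j'"
    have Xr: "?X r = s" using False late[of j' r] r ij j' by simp
    have Xc: "\<And>w. w \<in> set (\<xi> c) \<Longrightarrow> s \<le> ?X w" using late[of j'] nc ij j' by simp
    \<comment> \<open>No neighbour of c is below s, so r with load s is a minimum, and as head of
      \<open>\<xi> c\<close> it wins all ties. The second ball then stops at r, since no neighbour
      of r is below s either.\<close>
    have "next_vertex \<xi> ?X c = r"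
      using Xr Xc by (simp add: next_vertex_def \<xi>)
    moreover have "local_search \<xi> ?X r = r"
      by (intro local_search_stays) (use Xr late[of j'] nr ij j' in simp)
    moreover have "\<exists>w \<in> set (\<xi> c). ?X w < ?X c"
      using Xr cj by (auto simp: \<xi>)
    ultimately have "local_search \<xi> ?X c = r"
      by (subst local_search.simps) simp
    then show ?thesis using Xr ij j' by (simp add: Let_def)
  qed
  then show ?thesis using load_mono[of j i1 \<xi> U r] ij by simp
qed

text \<open>Stages are numbered from 0 here: stage s consists of balls s m + 1 to (s + 1) m and
  lifts \<open>R (Suc s)\<close> from load s to s + 1. The inclusions put r, c and the neighbours of
  both into \<open>R s\<close>, where the induction hypothesis gives load at least s, as
  \<open>load_ge_if_child_hit_twice\<close> demands.\<close>

lemma load_ge_if_all_stages_succeed: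
  fixes R :: "nat \<Rightarrow> 'a set"
  assumes sub: "\<And>s. s < k \<Longrightarrow> R (Suc s) \<subseteq> R s"
    and nb: "\<And>s r. \<lbrakk>s < k; r \<in> R (Suc s)\<rbrakk> \<Longrightarrow> set (\<xi> r) \<subseteq> R s"
    and hit: "\<And>s r. \<lbrakk>s < k; r \<in> R (Suc s)\<rbrakk> \<Longrightarrow>
      \<exists>c i j xs. c \<in> R s \<and> set (\<xi> c) \<subseteq> R s \<and> \<xi> c = r # xs \<and>
        s * m < i \<and> i < j \<and> j \<le> Suc s * m \<and> U i = c \<and> U j = c"
  shows "s \<le> k \<Longrightarrow> r \<in> R s \<Longrightarrow> s \<le> load \<xi> U (s * m) r"
proof (induction s arbitrary: r)
  case 0
  then show ?case by simp
next
  case (Suc s)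
  then have IH: "w \<in> R s \<Longrightarrow> s \<le> load \<xi> U (s * m) w" for w by simp
  obtain c i j xs where *: "c \<in> R s" "set (\<xi> c) \<subseteq> R s" "\<xi> c = r # xs"
     "s * m < i" "i < j" "j \<le> Suc s * m" "U i = c" "U j = c"
    using hit[of s r] Suc.prems by auto
  have sub': "R s \<supseteq> R (Suc s)" and nb': "set (\<xi> r) \<subseteq> R s"
    using sub[of s] nb[of s r] Suc.prems by auto
  show ?case
  proof (rule load_ge_if_child_hit_twice)
    show "\<xi> c = r # xs" "s * m < i" "i < j" "j \<le> Suc s * m" "U i = c" "U j = c"
      by fact+
    show "s \<le> load \<xi> U (s * m) w" if "w \<in> set (\<xi> r)" for w
      using that IH nb' by blast
    show "s \<le> load \<xi> U (s * m) w" if "w \<in> set (\<xi> c)" for w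
      using that IH *(2) by blast
    show "s \<le> load \<xi> U (s * m) r" "s \<le> load \<xi> U (s * m) c"
      using IH sub' *(1) Suc.prems by blast+
  qed
qed

section \<open>Repeated birthplaces\<close>

lemma measure_bind_pmf_of_set:
  assumes "finite V" "V \<noteq> {}"
  shows "measure_pmf.prob (bind_pmf (pmf_of_set V) f) E = (\<Sum>v\<in>V. measure_pmf.prob (f v) E) / card V"
proof -
  have "measure_pmf.prob (bind_pmf (pmf_of_set V) f) E
      = measure_pmf.expectation (pmf_of_set V) (\<lambda>v. measure_pmf.prob (f v) E)"
    using measurable_measure_pmf[of f] unfolding measure_pmf_bind
    by (subst measure_pmf.measure_bind[where N = "count_space UNIV"]) auto
  then show ?thesis
    using assms by (simp add: integral_pmf_of_set)
qed

text \<open>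
  By Bernoulli's inequality \<open>(1 + x)\<^sup>j + j y (1 + x)\<^sup>j\<^sup>-\<^sup>1 \<le> (1 + x + y)\<^sup>j\<close>, the right-hand side absorbs one
  more ball. This is why the claim is generalized from \<open>C\<close> to the set \<open>J\<close> of vertices that may still
  be hit.
\<close>

lemma prob_distinct_hits_le:
  fixes V :: "'a set" and W :: "'b set"
  assumes V: "finite V" "C \<subseteq> V" "C \<noteq> V" and W: "finite W"
  shows "J \<subseteq> C \<Longrightarrow> measure_pmf.prob (Pi_pmf W dflt (\<lambda>_. pmf_of_set V))
      {U. inj_on U {i \<in> W. U i \<in> C} \<and> (\<forall>i\<in>W. U i \<in> C \<longrightarrow> U i \<in> J)}
    \<le> (1 + card W / (real (card V) - card C)) ^ card J * (1 - card C / card V) ^ card W"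
  using W
proof (induction W arbitrary: J rule: finite_induct)
  case empty
  then show ?case by (simp add: indicator_def)
next
  case (insert a W)
  let ?p = "\<lambda>W. Pi_pmf W dflt (\<lambda>_. pmf_of_set V)"
  define E where "E W J = {U. inj_on U {i \<in> W. U i \<in> C} \<and> (\<forall>i\<in>W. U i \<in> C \<longrightarrow> U i \<in> J)}"
    for W :: "'b set" and J
  define n D where "n = card V" and "D = card C"
  have D: "D < n" unfolding n_def D_def using V by (intro psubset_card_mono) auto
  have finC: "finite C" using V finite_subset[of C V] by simp
  then have finJ: "finite J" using insert.prems finite_subset[of J C] by simp
  have ne: "V \<noteq> {}" using D by (auto simp: n_def)
  define q x y where "q = 1 - D / n" and "x = card W / (real n - D)" and "y = 1 / (real n - D)"
  have q: "q > 0" using D by (simp add: q_def)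
  have xy: "x \<ge> 0" "y > 0" using D by (auto simp: x_def y_def)
  \<comment> \<open>Fix the birthplace v of ball a. Outside C it changes nothing; in J it uses up v,
    leaving \<open>J - {v}\<close> to the other balls; in C but outside J it violates the
    event.\<close>
  have step: "measure_pmf.prob (?p W) ((\<lambda>f. f(a := v)) -` E (insert a W) J) \<le>
      (if v \<notin> C then (1 + x) ^ card J * q ^ card W
       else if v \<in> J then (1 + x) ^ (card J - 1) * q ^ card W else 0)" (is "?l \<le> ?r")
    for v
  proof -
    have inj: "inj_on (f(a := v)) {i \<in> insert a W. (f(a := v)) i \<in> C} \<longleftrightarrow>
        inj_on f {i \<in> W. f i \<in> C} \<and> (v \<in> C \<longrightarrow> (\<forall>i\<in>W. f i \<noteq> v))" for f :: "'b \<Rightarrow> 'a"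
    proof -
      have "{i \<in> insert a W. (f(a := v)) i \<in> C} = (if v \<in> C then insert a {i \<in> W. f i \<in> C} else {i \<in> W. f i \<in> C})"
        using insert.hyps by auto
      moreover have "inj_on (f(a := v)) {i \<in> W. f i \<in> C} \<longleftrightarrow> inj_on f {i \<in> W. f i \<in> C}"
        using insert.hyps by (intro inj_on_cong) auto
      moreover have "a \<notin> {i \<in> W. f i \<in> C}" using insert.hyps by simp
      ultimately show ?thesis
        using insert.hyps by (auto simp: image_iff)
    qed
    show ?thesis
    proof (cases "v \<in> C")
      case False
      have "(\<lambda>f. f(a := v)) -` E (insert a W) J \<subseteq> E W J"
        using False insert.hyps inj unfolding E_def by (auto simp: fun_upd_def split: if_splits)
      then have "?l \<le> measure_pmf.prob (?p W) (E W J)"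
        by (intro measure_pmf.finite_measure_mono) auto
      with insert.IH[OF insert.prems] False show ?thesis
        by (simp add: E_def x_def q_def n_def D_def)
    next
      case True
      show ?thesis
      proof (cases "v \<in> J")
        case False
        then have "(\<lambda>f. f(a := v)) -` E (insert a W) J = {}"
          using True unfolding E_def by auto
        then show ?thesis using True False by simp
      next
        case vJ: True
        have "(\<lambda>f. f(a := v)) -` E (insert a W) J \<subseteq> E W (J - {v})"
          using True insert.hyps inj unfolding E_def by (auto simp: fun_upd_def split: if_splits)
        then have "?l \<le> measure_pmf.prob (?p W) (E W (J - {v}))"
          by (intro measure_pmf.finite_measure_mono) auto
        moreover have "J - {v} \<subseteq> C" using insert.prems by auto
        ultimately show ?thesis
          using insert.IH[of "J - {v}"] True vJ finJ
          by (simp add: E_def x_def q_def n_def D_def)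
      qed
    qed
  qed
  let ?b = "(1 + x) ^ card J * q ^ card W" and ?b' = "(1 + x) ^ (card J - 1) * q ^ card W"
  have "measure_pmf.prob (?p (insert a W)) (E (insert a W) J)
      = (\<Sum>v\<in>V. measure_pmf.prob (?p W) ((\<lambda>f. f(a := v)) -` E (insert a W) J)) / n"
    using insert.hyps V(1) ne
    by (subst Pi_pmf_insert') (auto simp: measure_bind_pmf_of_set n_def simp flip: map_pmf_def)
  also have "\<dots> \<le> (\<Sum>v\<in>V. (if v \<notin> C then ?b else if v \<in> J then ?b' else 0)) / n"
    by (intro divide_right_mono sum_mono step) auto
  also have "(\<Sum>v\<in>V. (if v \<notin> C then ?b else if v \<in> J then ?b' else 0))
      = (\<Sum>v\<in>V - C. ?b) + (\<Sum>v\<in>J. ?b')"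
  proof -
    have "(\<Sum>v\<in>V. (if v \<notin> C then ?b else if v \<in> J then ?b' else 0)) =
       (\<Sum>v\<in>V - C. (if v \<notin> C then ?b else if v \<in> J then ?b' else 0)) +
       (\<Sum>v\<in>C. (if v \<notin> C then ?b else if v \<in> J then ?b' else 0))"
      using V by (intro sum.subset_diff) auto
    also have "(\<Sum>v\<in>C. (if v \<notin> C then ?b else if v \<in> J then ?b' else 0)) = (\<Sum>v\<in>J. ?b')"
      using insert.prems finC finJ by (intro sum.mono_neutral_cong_right) auto
    finally show ?thesis by simp
  qed
  also have "\<dots> = (real n - D) * ?b + card J * ?b'"
    using V finC D by (simp add: card_Diff_subset n_def D_def of_nat_diff)
  \<comment> \<open>Here (n - D) / n = q and 1 / n = q y.\<close>
  also have "\<dots> / n = q ^ Suc (card W) * ((1 + x) ^ card J + card J * y * (1 + x) ^ (card J - 1))"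
    using D by (simp add: q_def y_def field_simps)
  also have "(1 + x) ^ card J + card J * y * (1 + x) ^ (card J - 1) \<le> (1 + x + y) ^ card J"
  proof (cases "card J")
    case (Suc j)
    have "1 + real (Suc j) * (y / (1 + x)) \<le> (1 + y / (1 + x)) ^ Suc j"
      using xy by (intro Bernoulli_inequality) (smt (verit) divide_nonneg_nonneg)
    then have "(1 + x) ^ Suc j * (1 + real (Suc j) * (y / (1 + x)))
        \<le> (1 + x) ^ Suc j * (1 + y / (1 + x)) ^ Suc j"
      using xy by (intro mult_left_mono) auto
    also have "\<dots> = (1 + x + y) ^ Suc j"
    proof -
      have "1 + x + y = (1 + x) * (1 + y / (1 + x))" using xy by (simp add: field_simps)
      then show ?thesis by (simp only: power_mult_distrib)
    qed
    finally have le: "(1 + x) ^ Suc j * (1 + real (Suc j) * (y / (1 + x))) \<le> (1 + x + y) ^ Suc j" .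
    have "(1 + x) ^ Suc j * (y / (1 + x)) = y * (1 + x) ^ j"
      using xy by simp
    then have "(1 + x) ^ Suc j * (1 + real (Suc j) * (y / (1 + x)))
        = (1 + x) ^ Suc j + real (Suc j) * (y * (1 + x) ^ j)"
      by (simp only: distrib_left mult_1_right mult.left_commute[of "(1 + x) ^ Suc j" "real (Suc j)"])
    with le show ?thesis
      using Suc by (simp add: mult.assoc)
  qed simp
  also have "1 + x + y = 1 + card (insert a W) / (real n - D)"
    using insert.hyps by (simp add: x_def y_def add_divide_distrib)
  finally show ?case
    using q insert.hyps unfolding E_def by (simp add: q_def n_def D_def mult.commute mult_left_mono)
qed

text \<open>The event depends only on the balls in W, so the others are integrated out. The case
  \<open>J = C\<close> of \<open>prob_distinct_hits_le\<close> then applies, its second condition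
  being trivial.\<close>

lemma prob_no_double_hit_le:
  fixes V :: "'a set"
  assumes V: "finite V" "C \<subseteq> V" "C \<noteq> V" and I: "finite I" "W \<subseteq> I"
  shows "measure_pmf.prob (Pi_pmf I dflt (\<lambda>_. pmf_of_set V)) {U. inj_on U {i \<in> W. U i \<in> C}}
    \<le> (1 + card W / (real (card V) - card C)) ^ card C * (1 - card C / card V) ^ card W"
proof -
  have "finite W" using I finite_subset by blast
  have "{U. inj_on U {i \<in> W. U i \<in> C}} = (\<lambda>f x. if x \<in> W then f x else dflt) -`
      {U. inj_on U {i \<in> W. U i \<in> C} \<and> (\<forall>i\<in>W. U i \<in> C \<longrightarrow> U i \<in> C)}"
  proof -
    have "inj_on (\<lambda>x. if x \<in> W then f x else dflt) {i \<in> W. (if i \<in> W then f i else dflt) \<in> C} \<longleftrightarrow>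
        inj_on f {i \<in> W. f i \<in> C}" for f
    proof -
      have "{i \<in> W. (if i \<in> W then f i else dflt) \<in> C} = {i \<in> W. f i \<in> C}"
        by auto
      then show ?thesis
        by (auto intro!: inj_on_cong)
    qed
    then show ?thesis by auto
  qed
  then have "measure_pmf.prob (Pi_pmf I dflt (\<lambda>_. pmf_of_set V)) {U. inj_on U {i \<in> W. U i \<in> C}} =
    measure_pmf.prob (Pi_pmf W dflt (\<lambda>_. pmf_of_set V))
      {U. inj_on U {i \<in> W. U i \<in> C} \<and> (\<forall>i\<in>W. U i \<in> C \<longrightarrow> U i \<in> C)}"
    by (simp only: Pi_pmf_subset[OF I] measure_map_pmf)
  also have "\<dots> \<le> (1 + card W / (real (card V) - card C)) ^ card C * (1 - card C / card V) ^ card W"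
    by (rule prob_distinct_hits_le[OF V \<open>finite W\<close> subset_refl])
  finally show ?thesis .
qed

text \<open>A birthday-type estimate. In the exponent the linear terms D \<mu> and D m / n cancel up
  to 1, and the quadratic term of ln (1 + \<mu>) leaves a gain of D \<mu>^2 / 4, where \<mu> \<ge> 1
  / (2 k).\<close>

lemma stage_failure_bound:
  fixes n m D :: nat and k :: real
  assumes n: "0 < n" and k: "0 < k" and m: "real m \<le> n / 2" "n / (2 * k) \<le> m"
    and D: "1 \<le> D" "D + D ^ 2 \<le> n"
  shows "(1 + m / (real n - D)) ^ D * (1 - D / n) ^ m \<le> exp (1 - D / (16 * k ^ 2))"
proof -
  define \<mu> where "\<mu> = m / (real n - D)"
  have D2: "real D + real D ^ 2 \<le> n"
    using D(2) by (metis of_nat_add of_nat_le_iff of_nat_power)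
  moreover have "real D \<le> real D ^ 2" using D(1) by (simp add: power2_eq_square)
  ultimately have Dn: "2 * real D \<le> n" by linarith
  then have nD: "0 < real n - D" "n / 2 \<le> real n - D" using n D(1) by simp_all
  have \<mu>: "0 \<le> \<mu>" "\<mu> \<le> 1"
    using nD m(1) by (simp_all add: \<mu>_def field_simps)
  \<comment> \<open>An upper bound for ln (1 + \<mu>) on [0, 1]: t \<ge> 3 \<mu> / 4 gives t^2 / 2
    \<ge> \<mu>^2 / 4, so 1 + t + t^2 / 2 already reaches 1 + \<mu>.\<close>
  define t where "t = \<mu> - \<mu> ^ 2 / 4"
  have t: "t \<ge> 3 / 4 * \<mu>"
    using \<mu> by (simp add: t_def power2_eq_square mult_left_le)
  then have "(3 / 4 * \<mu>) ^ 2 \<le> t ^ 2"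
    using \<mu> by (intro power_mono) auto
  then have "\<mu> ^ 2 / 2 \<le> t ^ 2"
    by (simp add: power_mult_distrib power_divide) (smt (verit) zero_le_power2)
  then have "1 + \<mu> \<le> 1 + t + t ^ 2 / 2"
    by (simp add: t_def)
  also have "\<dots> \<le> exp t"
    using t \<mu> by (intro exp_lower_Taylor_quadratic) auto
  finally have 1: "(1 + \<mu>) ^ D \<le> exp (D * t)"
    using \<mu> by (subst exp_of_nat_mult) (intro power_mono, auto)
  have "1 - D / n \<le> exp (- (D / n))"
    using exp_ge_add_one_self[of "- (D / n)"] by simp
  moreover have "0 \<le> 1 - D / real n" using Dn n by (simp add: field_simps)
  ultimately have 2: "(1 - D / n) ^ m \<le> exp (m * - (D / n))"
    by (subst exp_of_nat_mult) (intro power_mono, auto)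
  have "(1 + \<mu>) ^ D * (1 - D / n) ^ m \<le> exp (D * t) * exp (m * - (D / n))"
    using 1 2 \<mu> \<open>0 \<le> 1 - D / real n\<close> by (intro mult_mono) auto
  also have "\<dots> = exp (D * t + m * - (D / n))"
    by (rule mult_exp_exp)
  also have "D * t + m * - (D / n) \<le> 1 - D / (16 * k ^ 2)"
  proof -
    \<comment> \<open>The linear terms differ by at most 1 because D^2 \<le> n - D and m \<le>
      n.\<close>
    have "D * \<mu> - m * (D / n) = (real D ^ 2 / (real n - D)) * (m / n)"
      using nD n by (simp add: \<mu>_def field_simps power2_eq_square)
    also have "\<dots> \<le> 1 * 1"
      using nD D2 m(1) n by (intro mult_mono) (auto simp: field_simps)
    finally have a: "D * \<mu> - m * (D / n) \<le> 1" by simp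
    have "1 / (2 * k) \<le> m / n" using m(2) n k by (simp add: field_simps)
    also have "\<dots> \<le> \<mu>" using nD n by (simp add: \<mu>_def frac_le)
    finally have "(1 / (2 * k)) ^ 2 \<le> \<mu> ^ 2" using k by (intro power_mono) auto
    then have "D * ((1 / (2 * k)) ^ 2 / 4) \<le> D * (\<mu> ^ 2 / 4)"
      by (intro mult_left_mono divide_right_mono) auto
    moreover have "D * ((1 / (2 * k)) ^ 2 / 4) = D / (16 * k ^ 2)"
      by (simp add: power_divide power_mult_distrib)
    ultimately show ?thesis using a by (simp add: t_def algebra_simps)
  qed
  finally show ?thesis by (simp add: \<mu>_def)
qed

lemma max_load_ge:
  assumes "finite (pverts G)" "v \<in> pverts G" "k \<le> load \<xi> U m v"
  shows "k \<le> max_load G \<xi> U m"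
  unfolding max_load_def using assms by (meson Max_ge finite_imageI image_eqI order.trans)

section \<open>A graph with high load\<close>

text \<open>\<open>P\<close> exempts vertices from having a preferred neighbour: the root of the
  tree, or all vertices of the circulant graph.\<close>

lemma tie_breaking_rule_prefer:
  assumes "finite V" "A \<subseteq> V \<times> V" "\<And>v. v \<in> V \<Longrightarrow> P v \<Longrightarrow> (v, p v) \<in> A"
  obtains \<xi> where "tie_breaking_rule \<lparr>pverts = V, parcs = A\<rparr> \<xi>"
    "\<And>v. v \<in> V \<Longrightarrow> set (\<xi> v) = A `` {v}" "\<And>v. v \<in> V \<Longrightarrow> P v \<Longrightarrow> \<exists>xs. \<xi> v = p v # xs"
proof -
  have "\<exists>l. l \<in> permutations_of_set (A `` {v}) \<and> (P v \<longrightarrow> (\<exists>xs. l = p v # xs))" if "v \<in> V" for v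
  proof -
    have fin: "finite (A `` {v})" by (rule finite_subset[OF _ assms(1)]) (use assms(2) in auto)
    show ?thesis
    proof (cases "P v")
      case True
      obtain xs where "set xs = A `` {v} - {p v}" "distinct xs"
        using fin finite_distinct_list[of "A `` {v} - {p v}"] by auto
      then have "p v # xs \<in> permutations_of_set (A `` {v})"
        using assms(3)[OF that True] by (auto simp: permutations_of_set_def)
      then show ?thesis by blast
    next
      case False
      obtain xs where "set xs = A `` {v}" "distinct xs"
        using fin finite_distinct_list by blast
      then show ?thesis using False by (auto simp: permutations_of_set_def)
    qed
  qed
  then obtain \<xi> where \<xi>: "\<And>v. v \<in> V \<Longrightarrow>
      \<xi> v \<in> permutations_of_set (A `` {v}) \<and> (P v \<longrightarrow> (\<exists>xs. \<xi> v = p v # xs))"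
    by metis
  have "neighbours \<lparr>pverts = V, parcs = A\<rparr> v = A `` {v}" for v
    by (auto simp: neighbours_def)
  then show ?thesis
    using \<xi> by (intro that[of \<xi>]) (auto simp: tie_breaking_rule_def permutations_of_set_def)
qed

text \<open>The subtracted term is a union bound over fewer than k stages' worth of failures at
  vertices below (d + 1)^(2 k), counted as at most k (d + 1)^(2 k) pairs. The lower bound on n
  ensures that all these vertices have only tree neighbours.\<close>

lemma ex_high_load_graph:
  assumes d: "5 \<le> d" and k: "2 \<le> k" and kd: "real k \<le> real d powr (1 / 4)"
    and n: "(d + 1) ^ (2 * k + 1) \<le> n" and ev: "even (d * n)"
  shows "\<exists>(G :: nat pair_pre_digraph) \<xi>. regular_graph d G \<and>
    Digraph_Component.connected (with_proj G) \<and> card (pverts G) = n \<and> tie_breaking_rule G \<xi> \<and>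
    1 - k * real (d + 1) ^ (2 * k) * exp (1 - sqrt d / 32)
      \<le> measure_pmf.prob (birthplaces G n) {U. k \<le> max_load G \<xi> U n}"
proof -
  have "(d + 1) ^ 5 \<le> (d + 1) ^ (2 * k + 1)" using k by (intro power_increasing) auto
  with n have n5: "(d + 1) ^ 5 \<le> n" by simp
  moreover have "(d + 1) ^ 2 \<le> (d + 1) ^ 5" by (intro power_increasing) auto
  ultimately have n2: "(d + 1) ^ 2 \<le> n" by simp
  then have nd2: "d ^ 2 \<le> n" "2 * d \<le> n" "0 < n" "d - 1 + (d - 1) ^ 2 \<le> n"
  proof -
    have "(d - 1) + (d - 1) ^ 2 = (d - 1) * d" using d by (cases d) (simp_all add: power2_eq_square)
    also have "\<dots> \<le> d * d" by simp
    finally show "d ^ 2 \<le> n" "2 * d \<le> n" "0 < n" "d - 1 + (d - 1) ^ 2 \<le> n"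
      using n2 by (simp_all add: power2_eq_square)
  qed
  have "real d powr (1 / 4) \<le> real d powr 1" using d by (intro powr_mono) auto
  with kd d have "real k \<le> real d" by simp
  then have "k \<le> d" by simp
  define m where "m = n div k"
  have km: "k * m \<le> n" by (simp add: m_def)
  have m1: "real m \<le> n / 2"
  proof -
    have "m * 2 \<le> m * k" using k by simp
    also have "\<dots> \<le> n" using km by (simp add: mult.commute)
    finally have "real (m * 2) \<le> real n" by (rule of_nat_mono)
    then show ?thesis by simp
  qed
  have m2: "real n / (2 * real k) \<le> m"
  proof -
    have "n < k * m + k" using k dividend_less_times_div[of k n] by (simp add: m_def)
    then have "real n < real (k * m + k)" by (simp only: of_nat_less_iff)
    moreover have "2 * real k \<le> n" using \<open>k \<le> d\<close> nd2(2) by linarith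
    ultimately have "real n \<le> 2 * (real k * real m)" by simp
    then have "real n \<le> m * (2 * real k)" by (simp add: mult_ac)
    then show ?thesis using k by (simp add: pos_divide_le_eq)
  qed

  obtain A where A: "A \<subseteq> {0..<n} \<times> {0..<n}" "sym A" "irrefl A"
      "\<And>v. v \<in> {0..<n} \<Longrightarrow> card (A `` {v}) = d"
      "\<And>i. \<lbrakk>0 < i; i < n\<rbrakk> \<Longrightarrow> (i, heap_parent d i) \<in> A"
      "\<And>v w. \<lbrakk>(d + 1) * (v + 1) \<le> n; (v, w) \<in> A\<rbrakk> \<Longrightarrow> w < (d + 1) * (v + 1)"
    using heap_regular_relation[OF d nd2(1) ev] by blast
  define G where "G = \<lparr>pverts = {0..<n}, parcs = A\<rparr>"
  have "(v, heap_parent d v) \<in> A" if "v \<in> {0..<n}" "0 < v" for v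
    using A(5) that by simp
  then obtain \<xi> where \<xi>: "tie_breaking_rule G \<xi>" "\<And>v. v \<in> {0..<n} \<Longrightarrow> set (\<xi> v) = A `` {v}"
      "\<And>v. \<lbrakk>v \<in> {0..<n}; 0 < v\<rbrakk> \<Longrightarrow> \<exists>xs. \<xi> v = heap_parent d v # xs"
    using tie_breaking_rule_prefer[of "{0..<n}" A "\<lambda>v. 0 < v" "heap_parent d"] A(1)
    unfolding G_def by blast
  \<comment> \<open>The root has d children, all other vertices concerned d - 1; trimming to d - 1
    gives one bound for all.\<close>
  have "\<exists>C \<subseteq> heap_children d n r. card C = d - 1" if "(d + 1) * (r + 1) \<le> n" for r
    using card_heap_children_ge[of d r n] that d by (metis (no_types, lifting) le_trans numeral_le_iff
      obtain_subset_with_card_n semiring_norm(68,72))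
  then obtain C where C: "\<And>r. (d + 1) * (r + 1) \<le> n \<Longrightarrow> C r \<subseteq> heap_children d n r \<and> card (C r) = d - 1"
    by metis
  \<comment> \<open>Neighbours grow by a factor of at most \<open>d + 1\<close>, so \<open>R s\<close> contains the ball of radius \<open>2 (k - s)\<close> around 0.\<close>
  define R where "R s = {r. r < (d + 1) ^ (2 * (k - s))}" for s
  define W where "W s = {s * m<..Suc s * m}" for s
  define E where "E s r = {U. inj_on U {i \<in> W s. U i \<in> C r}}" for s and r :: nat
  define I where "I = Sigma {..<k} (\<lambda>s. R (Suc s))"
  \<comment> \<open>Passing from r to its neighbours and on to theirs costs two factors d + 1, which
    is why the exponent in \<open>R\<close> drops by 2 per stage.\<close>
  have R_Suc: "(d + 1) * ((d + 1) * (r + 1)) \<le> (d + 1) ^ (2 * (k - s))"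
    if "s < k" "r \<in> R (Suc s)" for r s
  proof -
    have "2 * (k - s) = Suc (Suc (2 * (k - Suc s)))" using that by simp
    moreover have "r + 1 \<le> (d + 1) ^ (2 * (k - Suc s))" using that(2) by (simp add: R_def)
    ultimately show ?thesis by (metis mult_le_mono2 power_Suc)
  qed
  have R_n: "(d + 1) * v \<le> n" if "v \<le> (d + 1) ^ (2 * (k - s))" for v s
  proof -
    have "(d + 1) * v \<le> (d + 1) ^ Suc (2 * (k - s))"
      unfolding power_Suc using that by (rule mult_le_mono2)
    also have "\<dots> \<le> (d + 1) ^ (2 * k + 1)" by (intro power_increasing) auto
    finally show ?thesis using n by simp
  qed
  have r_n: "(d + 1) * (r + 1) \<le> n" "(d + 1) * ((d + 1) * (r + 1)) \<le> n"
    if "s < k" "r \<in> R (Suc s)" for r s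
  proof -
    show "(d + 1) * (r + 1) \<le> n"
      using that(2) by (intro R_n[of _ "Suc s"]) (simp add: R_def)
    have "(d + 1) * (r + 1) \<le> (d + 1) * ((d + 1) * (r + 1))" by (intro mult_le_mono2) simp
    then have "(d + 1) * (r + 1) \<le> (d + 1) ^ (2 * (k - s))"
      using R_Suc[OF that] by linarith
    then show "(d + 1) * ((d + 1) * (r + 1)) \<le> n" by (rule R_n)
  qed
  have R_nb: "set (\<xi> r) \<subseteq> R s" "\<And>c. c \<in> A `` {r} \<Longrightarrow> set (\<xi> c) \<subseteq> R s" "r < n" "r \<in> R s"
    if "s < k" "r \<in> R (Suc s)" for r s
  proof -
    note b = R_Suc[OF that] r_n[OF that]
    have le: "(d + 1) * (r + 1) \<le> (d + 1) * ((d + 1) * (r + 1))" "r + 1 \<le> (d + 1) * (r + 1)"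
      by (intro mult_le_mono2) simp_all
    show "r < n" using b(2) le(2) by linarith
    have nr: "w < (d + 1) * (r + 1)" if "w \<in> A `` {r}" for w
      using A(6)[OF b(2)] that by blast
    have "w < (d + 1) ^ (2 * (k - s))" if "w < (d + 1) * (r + 1)" for w
      using that b(1) le(1) by linarith
    then show "set (\<xi> r) \<subseteq> R s" "r \<in> R s"
      using \<xi>(2)[of r] \<open>r < n\<close> nr le(2) by (auto simp: R_def)
    show "set (\<xi> c) \<subseteq> R s" if c: "c \<in> A `` {r}" for c
    proof
      fix w assume w: "w \<in> set (\<xi> c)"
      have "c < n" using c A(1) by auto
      then have "(c, w) \<in> A" using w \<xi>(2) by auto
      have "c + 1 \<le> (d + 1) * (r + 1)" using nr[OF c] by simp
      then have le: "(d + 1) * (c + 1) \<le> (d + 1) * ((d + 1) * (r + 1))"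
        by (rule mult_le_mono2)
      then have "(d + 1) * (c + 1) \<le> n" using b(3) by linarith
      from A(6)[OF this \<open>(c, w) \<in> A\<close>] le b(1) show "w \<in> R s"
        unfolding R_def mem_Collect_eq by linarith
    qed
  qed

  have good: "k \<le> max_load G \<xi> U n" if U: "U \<notin> (\<Union>(s, r)\<in>I. E s r)" for U
  proof -
    \<comment> \<open>\<open>R k\<close> is the singleton of the root, as its exponent is 0.\<close>
    have "k \<le> load \<xi> U (k * m) 0"
    proof (rule load_ge_if_all_stages_succeed[where R = R and k = k])
      fix s r assume s: "s < k" and r: "r \<in> R (Suc s)"
      show "set (\<xi> r) \<subseteq> R s" by (rule R_nb[OF s r])
      from s r have "U \<notin> E s r" using U by (auto simp: I_def)
      then obtain i j where "i \<in> W s" "j \<in> W s" "U i = U j" "U i \<in> C r" "i \<noteq> j"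
        by (auto simp: E_def inj_on_def)
      then obtain i j where ij: "i \<in> W s" "j \<in> W s" "U i = U j" "U i \<in> C r" "i < j"
        by (metis linorder_neqE_nat)
      define c where "c = U i"
      have c: "0 < c" "c < n" "heap_parent d c = r"
        using C[OF r_n(1)[OF s r]] ij(4) by (auto simp: c_def heap_children_def)
      then have "c \<in> A `` {r}" using A(5)[of c] A(2) by (auto dest: symD)
      moreover obtain xs where "\<xi> c = r # xs" using \<xi>(3)[of c] c by auto
      moreover have "c \<in> R s" using R_nb(1)[OF s r] \<open>c \<in> A `` {r}\<close> \<xi>(2) R_nb(3)[OF s r] by auto
      moreover have "set (\<xi> c) \<subseteq> R s" by (rule R_nb(2)[OF s r \<open>c \<in> A `` {r}\<close>])
      moreover have "s * m < i" "j \<le> Suc s * m" "U i = c" "U j = c"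
        using ij by (auto simp: W_def c_def)
      ultimately show "\<exists>c i j xs. c \<in> R s \<and> set (\<xi> c) \<subseteq> R s \<and> \<xi> c = r # xs \<and>
          s * m < i \<and> i < j \<and> j \<le> Suc s * m \<and> U i = c \<and> U j = c"
        using ij(5) by blast
    next
      show "R (Suc s) \<subseteq> R s" if "s < k" for s using R_nb(4)[OF that] by blast
    qed (simp_all add: R_def)
    \<comment> \<open>The n mod k balls after the last stage cannot lower a load.\<close>
    also have "\<dots> \<le> load \<xi> U n 0" using km by (rule load_mono)
    finally show ?thesis
      using nd2(3) by (intro max_load_ge[of _ 0]) (auto simp: G_def)
  qed

  have pE: "measure_pmf.prob (birthplaces G n) (E s r) \<le> exp (1 - sqrt d / 32)"
    if s: "s < k" and r: "r \<in> R (Suc s)" for s r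
  proof -
    note Cr = C[OF r_n(1)[OF s r]]
    have "Suc s * m \<le> k * m" using s by (intro mult_le_mono1) simp
    then have "W s \<subseteq> {1..n}" using km by (auto simp: W_def)
    moreover have "C r \<subseteq> {0..<n}" using Cr by (auto simp: heap_children_def)
    moreover have "C r \<noteq> {0..<n}" using Cr nd2(2,3) by auto
    ultimately have "measure_pmf.prob (birthplaces G n) (E s r)
        \<le> (1 + card (W s) / (real (card {0..<n}) - card (C r))) ^ card (C r)
          * (1 - card (C r) / card {0..<n}) ^ card (W s)"
      unfolding birthplaces_def E_def G_def
      by (simp only: pair_pre_digraph.simps) (rule prob_no_double_hit_le; simp)
    also have "\<dots> = (1 + m / (real n - real (d - 1))) ^ (d - 1) * (1 - real (d - 1) / n) ^ m"
      using Cr by (simp add: W_def)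
    also have "\<dots> \<le> exp (1 - real (d - 1) / (16 * real k ^ 2))"
      using nd2 k d by (intro stage_failure_bound m1 m2) auto
    also have "\<dots> \<le> exp (1 - sqrt d / 32)"
    proof -
      \<comment> \<open>From k^2 \<le> sqrt d and d - 1 \<ge> d / 2 the exponent (d - 1) / (16 k^2)
        is at least sqrt d / 32.\<close>
      have "real k ^ 2 \<le> (real d powr (1 / 4)) ^ 2" using kd by (intro power_mono) auto
      also have "\<dots> = sqrt d"
        using d by (simp add: powr_power powr_half_sqrt)
      finally have "sqrt d * real k ^ 2 \<le> sqrt d * sqrt d" by (intro mult_left_mono) auto
      also have "\<dots> = real d" by simp
      also have "\<dots> \<le> 2 * real (d - 1)" using d by (simp add: of_nat_diff)
      finally have "sqrt d / 32 \<le> real (d - 1) / (16 * real k ^ 2)"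
        using k by (simp add: field_simps)
      then show ?thesis by simp
    qed
    finally show ?thesis .
  qed

  have finI: "finite I" by (auto simp: I_def R_def)
  have cI: "real (card I) \<le> k * real (d + 1) ^ (2 * k)"
  proof -
    have "card I = (\<Sum>s<k. card (R (Suc s)))" by (simp add: I_def R_def)
    also have "\<dots> \<le> card {..<k} * (d + 1) ^ (2 * k)"
    proof (rule sum_bounded_above[where K = "(d + 1) ^ (2 * k)", simplified of_nat_id])
      show "card (R (Suc s)) \<le> (d + 1) ^ (2 * k)" for s
        unfolding R_def by (simp only: card_Collect_less_nat) (intro power_increasing, auto)
    qed
    finally have "card I \<le> k * (d + 1) ^ (2 * k)" by simp
    then have "real (card I) \<le> real (k * (d + 1) ^ (2 * k))" by (rule of_nat_mono)
    then show ?thesis by simp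
  qed
  let ?P = "measure_pmf.prob (birthplaces G n)"
  have "?P (\<Union>(s, r)\<in>I. E s r) \<le> (\<Sum>(s, r)\<in>I. ?P (E s r))"
    using measure_pmf.finite_measure_subadditive_finite[OF finI, of "\<lambda>(s, r). E s r" "birthplaces G n"]
    by (simp add: case_prod_unfold)
  also have "\<dots> \<le> (\<Sum>(s, r)\<in>I. exp (1 - sqrt d / 32))"
    using pE by (intro sum_mono) (auto simp: I_def)
  also have "\<dots> = card I * exp (1 - sqrt d / 32)" by (simp add: case_prod_unfold)
  also have "\<dots> \<le> k * real (d + 1) ^ (2 * k) * exp (1 - sqrt d / 32)"
    using cI by (intro mult_right_mono) auto
  finally have "?P (\<Union>(s, r)\<in>I. E s r) \<le> k * real (d + 1) ^ (2 * k) * exp (1 - sqrt d / 32)" .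
  moreover have "?P (- (\<Union>(s, r)\<in>I. E s r)) \<le> ?P {U. k \<le> max_load G \<xi> U n}"
    using good by (intro measure_pmf.finite_measure_mono) auto
  moreover have "?P (- (\<Union>(s, r)\<in>I. E s r)) = 1 - ?P (\<Union>(s, r)\<in>I. E s r)"
    using measure_pmf.prob_compl[of "\<Union>(s, r)\<in>I. E s r" "birthplaces G n"] by (simp add: Compl_eq_Diff_UNIV)
  ultimately have "1 - k * real (d + 1) ^ (2 * k) * exp (1 - sqrt d / 32) \<le> ?P {U. k \<le> max_load G \<xi> U n}"
    by linarith
  moreover have "regular_graph d G"
    unfolding G_def using A(1-4) by (intro regular_graph_relI) auto
  moreover have "Digraph_Component.connected (with_proj G)"
    unfolding G_def using A(5) heap_parent_less nd2(3) by (intro connected_if_parent[where par = "heap_parent d"]) auto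
  moreover have "card (pverts G) = n" by (simp add: G_def)
  ultimately show ?thesis using \<xi>(1) by blast
qed

text \<open>On the support of the law, ball n is born at a vertex and hence placed at one, which
  then has load at least 1. This settles the case of a bounded minimum.\<close>

lemma ex_graph_max_load_pos:
  assumes "2 \<le> d" "d < n" "even (d * n)"
  shows "\<exists>(G :: nat pair_pre_digraph) \<xi>. regular_graph d G \<and>
    Digraph_Component.connected (with_proj G) \<and> card (pverts G) = n \<and> tie_breaking_rule G \<xi> \<and>
    (\<forall>U \<in> set_pmf (birthplaces G n). 1 \<le> max_load G \<xi> U n)"
proof -
  obtain A where A: "A \<subseteq> {0..<n} \<times> {0..<n}" "sym A" "irrefl A"
    "\<And>v. v \<in> {0..<n} \<Longrightarrow> card (A `` {v}) = d" "\<And>i. \<lbrakk>0 < i; i < n\<rbrakk> \<Longrightarrow> (i, i - 1) \<in> A"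
    using circulant_relation[OF assms] by blast
  define G where "G = \<lparr>pverts = {0..<n}, parcs = A\<rparr>"
  obtain \<xi> where \<xi>: "tie_breaking_rule G \<xi>" "\<And>v. v \<in> {0..<n} \<Longrightarrow> set (\<xi> v) = A `` {v}"
    using tie_breaking_rule_prefer[of "{0..<n}" A "\<lambda>_. False"] A(1) unfolding G_def by auto
  have "1 \<le> max_load G \<xi> U n" if "U \<in> set_pmf (birthplaces G n)" for U
  proof -
    obtain n' where n': "n = Suc n'" using assms(2) by (cases n) auto
    have "U n \<in> set_pmf (pmf_of_set {0..<n})"
      using that n' by (auto simp: birthplaces_def set_Pi_pmf PiE_dflt_def G_def)
    then have "U n \<in> {0..<n}" using n' by (subst (asm) set_pmf_of_set) auto
    define v where "v = local_search \<xi> (load \<xi> U n') (U n)"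
    have "v \<in> {0..<n}"
      unfolding v_def by (rule local_search_closed) (use \<xi>(2) A(1) \<open>U n \<in> {0..<n}\<close> in auto)
    moreover have "1 \<le> load \<xi> U n v" by (simp add: n' Let_def v_def)
    ultimately show ?thesis by (intro max_load_ge[of _ v]) (auto simp: G_def)
  qed
  moreover have "regular_graph d G"
    unfolding G_def using A by (intro regular_graph_relI) auto
  moreover have "Digraph_Component.connected (with_proj G)"
    unfolding G_def using A(5) assms by (intro connected_if_parent[where par = "\<lambda>i. i - 1"]) auto
  moreover have "card (pverts G) = n" by (simp add: G_def)
  ultimately show ?thesis using \<xi>(1) by blast
qed

section \<open>Choice of the number of stages and passage to the limit\<close>

definition failure_bound :: "real \<Rightarrow> real" where
  "failure_bound x = x powr (1 / 4) * (x + 1) powr (2 * x powr (1 / 4)) * exp (1 - sqrt x / 32)"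

text \<open>\<open>failure_bound\<close> is the failure term of \<open>ex_high_load_graph\<close>
  with k replaced by its upper bound d^(1/4), hence a function of d alone. The logarithm of its
  middle factor is 2 x^(1/4) ln (x + 1), which is dominated by sqrt x / 32.\<close>

lemma failure_bound_tendsto_0: "(failure_bound \<longlongrightarrow> 0) at_top"
  unfolding failure_bound_def by real_asymp

lemma ex_graph_max_load_ge_min:
  assumes d: "5 \<le> d" "d < n" and ev: "even (d * n)"
  shows "\<exists>(G :: nat pair_pre_digraph) \<xi>. regular_graph d G \<and>
    Digraph_Component.connected (with_proj G) \<and> card (pverts G) = n \<and> tie_breaking_rule G \<xi> \<and>
    1 - failure_bound d \<le> measure_pmf.prob (birthplaces G n)
      {U. real (max_load G \<xi> U n) \<ge> 1 / 12 * min (real d powr (1 / 4)) (ln n / ln d)}"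
proof -
  define M where "M = min (real d powr (1 / 4)) (ln n / ln d)"
  have M: "M \<le> real d powr (1 / 4)" "M \<le> ln n / ln d" by (simp_all add: M_def)
  show ?thesis
  \<comment> \<open>For M \<le> 12 the target M / 12 is at most 1, and a single ball
    suffices.\<close>
  proof (cases "M \<le> 12")
    case True
    obtain G :: "nat pair_pre_digraph" and \<xi> where G: "regular_graph d G"
      "Digraph_Component.connected (with_proj G)" "card (pverts G) = n" "tie_breaking_rule G \<xi>"
      and load: "\<And>U. U \<in> set_pmf (birthplaces G n) \<Longrightarrow> 1 \<le> max_load G \<xi> U n"
      using ex_graph_max_load_pos[of d n] assms by auto
    have "1 / 12 * M \<le> max_load G \<xi> U n" if "U \<in> set_pmf (birthplaces G n)" for U
      using load[OF that] True by linarith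
    then have "measure_pmf.prob (birthplaces G n) {U. real (max_load G \<xi> U n) \<ge> 1 / 12 * M} = 1"
      by (subst measure_pmf.prob_eq_1) (auto simp: AE_measure_pmf_iff)
    moreover have "0 \<le> failure_bound d" by (simp add: failure_bound_def)
    ultimately show ?thesis using G unfolding M_def[symmetric] by force
  next
    case False
    \<comment> \<open>M > 12 makes rounding up harmless: 2 \<le> k \<le> M / 12 + 1 \<le> M / 6, and
      thus 2 k + 1 \<le> M / 3 + 1 \<le> M / 2.\<close>
    define k where "k = nat \<lceil>M / 12\<rceil>"
    have k: "M / 12 \<le> k" "real k \<le> M / 6" "2 \<le> k" using False unfolding k_def by linarith+
    then have kM: "real (2 * k + 1) \<le> M / 2" using False by simp
    have lnd: "0 < ln (real d)" using d by simp
    \<comment> \<open>Replacing ln (d + 1) by 2 ln d uses up the factor 1 / 2 in \<open>kM\<close>: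
      (2 k + 1) ln (d + 1) \<le> M ln d \<le> ln n.\<close>
    have "real (d + 1) \<le> real d ^ 2"
    proof -
      have "d + 1 \<le> d * d" using d(1) by (cases d) auto
      then have "real (d + 1) \<le> real (d * d)" by (rule of_nat_mono)
      then show ?thesis by (simp add: power2_eq_square)
    qed
    then have "ln (real (d + 1)) \<le> ln (real d ^ 2)" using d by (subst ln_le_cancel_iff) auto
    also have "\<dots> = 2 * ln d" using d by (subst ln_realpow) auto
    finally have "real (2 * k + 1) * ln (real (d + 1)) \<le> M / 2 * (2 * ln d)"
      using kM by (intro mult_mono) auto
    also have "\<dots> \<le> ln n" using M(2) lnd by (simp add: pos_le_divide_eq)
    finally have "ln (real (d + 1) ^ (2 * k + 1)) \<le> ln n" using d by (subst ln_realpow) auto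
    then have "real (d + 1) ^ (2 * k + 1) \<le> n"
      using d by (subst (asm) ln_le_cancel_iff) auto
    then have kn: "(d + 1) ^ (2 * k + 1) \<le> n" by (simp only: of_nat_power[symmetric] of_nat_le_iff)
    have kd: "real k \<le> real d powr (1 / 4)" using k(2) M(1) False by linarith
    obtain G :: "nat pair_pre_digraph" and \<xi> where G: "regular_graph d G"
      "Digraph_Component.connected (with_proj G)" "card (pverts G) = n" "tie_breaking_rule G \<xi>"
      and p: "1 - k * real (d + 1) ^ (2 * k) * exp (1 - sqrt d / 32)
        \<le> measure_pmf.prob (birthplaces G n) {U. k \<le> max_load G \<xi> U n}"
      using ex_high_load_graph[OF d(1) k(3) kd kn ev] by blast
    have "real (d + 1) ^ (2 * k) = real (d + 1) powr (2 * real k)"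
      by (subst powr_realpow[symmetric]) auto
    also have "\<dots> \<le> real (d + 1) powr (2 * real d powr (1 / 4))"
      using kd by (intro powr_mono) auto
    finally have "k * real (d + 1) ^ (2 * k) * exp (1 - sqrt d / 32) \<le> failure_bound d"
      unfolding failure_bound_def using kd by (intro mult_mono) (auto simp: add.commute)
    moreover have "measure_pmf.prob (birthplaces G n) {U. k \<le> max_load G \<xi> U n}
        \<le> measure_pmf.prob (birthplaces G n) {U. real (max_load G \<xi> U n) \<ge> 1 / 12 * M}"
    proof (intro measure_pmf.finite_measure_mono subsetI CollectI)
      fix U assume "U \<in> {U. k \<le> max_load G \<xi> U n}"
      then have "real k \<le> max_load G \<xi> U n" by simp
      then show "1 / 12 * M \<le> real (max_load G \<xi> U n)" using k(1) by linarith
    qed auto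
    ultimately have "1 - failure_bound d
        \<le> measure_pmf.prob (birthplaces G n) {U. real (max_load G \<xi> U n) \<ge> 1 / 12 * M}"
      using p by linarith
    then show ?thesis using G unfolding M_def by blast
  qed
qed

theorem theorem1p5:
  fixes d :: "nat \<Rightarrow> nat"
  assumes "filterlim d at_top sequentially"
    and "\<forall>\<^sub>F n in sequentially. d n < n \<and> even (d n * n)"
  shows "\<exists>(G :: nat \<Rightarrow> nat pair_pre_digraph) (\<xi> :: nat \<Rightarrow> nat \<Rightarrow> nat list) (c :: real).
    c > 0 \<and>
    (\<forall>\<^sub>F n in sequentially.
       regular_graph (d n) (G n) \<and> Digraph_Component.connected (with_proj (G n)) \<and>
       card (pverts (G n)) = n \<and> tie_breaking_rule (G n) (\<xi> n)) \<and>
    (\<lambda>n. measure_pmf.prob (birthplaces (G n) n)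
       {U. real (max_load (G n) (\<xi> n) U n)
             \<ge> c * min (real (d n) powr (1 / 4)) (ln (real n) / ln (real (d n)))})
      \<longlonglongrightarrow> 1"
proof -
  define p where "p n G \<xi> = measure_pmf.prob (birthplaces G n)
    {U. real (max_load G \<xi> U n) \<ge> 1 / 12 * min (real (d n) powr (1 / 4)) (ln (real n) / ln (real (d n)))}"
    for n and G :: "nat pair_pre_digraph" and \<xi>
  define Q where "Q n G \<xi> \<longleftrightarrow> (regular_graph (d n) G \<and> Digraph_Component.connected (with_proj G) \<and>
    card (pverts G) = n \<and> tie_breaking_rule G \<xi>) \<and> 1 - failure_bound (d n) \<le> p n G \<xi>"
    for n and G :: "nat pair_pre_digraph" and \<xi>
  \<comment> \<open>The hypotheses stand below the quantifiers so that a graph and a rule can be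
    chosen for every n; where they fail, which is only for finitely many n, the choice is
    arbitrary.\<close>
  have "\<exists>G \<xi>. 5 \<le> d n \<and> d n < n \<and> even (d n * n) \<longrightarrow> Q n G \<xi>" for n
    using ex_graph_max_load_ge_min[of "d n" n] unfolding Q_def p_def by blast
  then obtain G \<xi> where Q: "\<And>n. 5 \<le> d n \<and> d n < n \<and> even (d n * n) \<longrightarrow> Q n (G n) (\<xi> n)"
    by metis
  have ev: "\<forall>\<^sub>F n in sequentially. Q n (G n) (\<xi> n)"
    using assms(2) filterlim_at_top[THEN iffD1, OF assms(1), rule_format, of 5]
    by eventually_elim (use Q in blast)
  have "(\<lambda>n. p n (G n) (\<xi> n)) \<longlonglongrightarrow> 1"
  proof (rule tendsto_sandwich)
    have "filterlim (\<lambda>n. real (d n)) at_top sequentially"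
      by (rule filterlim_compose[OF filterlim_real_sequentially assms(1)])
    then have "(\<lambda>n. failure_bound (d n)) \<longlonglongrightarrow> 0"
      by (rule filterlim_compose[OF failure_bound_tendsto_0])
    then show "(\<lambda>n. 1 - failure_bound (d n)) \<longlonglongrightarrow> 1"
      using tendsto_diff[OF tendsto_const, of _ 0 sequentially 1] by simp
    show "\<forall>\<^sub>F n in sequentially. 1 - failure_bound (d n) \<le> p n (G n) (\<xi> n)"
      using ev by eventually_elim (simp add: Q_def)
  qed (auto simp: p_def)
  moreover have "\<forall>\<^sub>F n in sequentially.
       regular_graph (d n) (G n) \<and> Digraph_Component.connected (with_proj (G n)) \<and>
       card (pverts (G n)) = n \<and> tie_breaking_rule (G n) (\<xi> n)"
    using ev by eventually_elim (simp add: Q_def)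
  ultimately show ?thesis
    unfolding p_def by (intro exI[of _ G] exI[of _ \<xi>] exI[of _ "1 / 12"]) simp
qed

end
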